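(* Let $n$ be odd, $q=2^n$, and let $L(X)=\sum_{i=0}^{n-1}a_iX^{2^i}\in\mathbb{F}_q[X]$ be a linearized polynomial with adjoint $\bar{L}(X)=\sum_{i=0}^{n-1}a_i^{2^{n-i}}X^{2^{n-i}}$. Then the set $\{(x,L(x)):x\in\mathbb{F}_q\}\cup\{(0),(\infty)\}$ is a hyperoval in $\Pi(\mathbb{K}_n)$ if and only if the set of lines $$\mathcal{L}_c=\{l_{m,\bar{L}(m)}: m\in\mathbb{F}_q\}\cup\{l_0,l_\infty\},$$ where $l_{m,\bar L(m)}=\{(x,y): y=x\circ m+\bar{L}(m)\}\cup\{(m)\}$, is a line hyperoval in $\Pi(\mathbb{K}_n^{td})$.
   Context: $\mathrm{Tr}:\mathbb{F}_q\to\mathbb{F}_2$ is the absolute trace. Knuth's presemifield $\mathbb{K}_n=(\mathbb{F}_q,+,* )$ ($n$ odd) has $x*y=xy+(y\,\mathrm{Tr}(x)+x\,\mathrm{Tr}(y))^2$; the presemifield $\mathbb{K}_n^{td}=(\mathbb{F}_q,+,\circ)$ has $x\circ y=xy+\mathrm{Tr}(x)\,y^{2^{n-1}}+\mathrm{Tr}(x^2y)$. For a presemifield $(\mathbb{F}_q,+,\star)$, the plane $\Pi$ has affine points $(a,b)$, points at infinity $(a)$, $a\in\mathbb{F}_q\cup\{\infty\}$, and lines: $l_\infty$ (the line at infinity, all points $(a)$); $l_a=\{(a,y):y\in\mathbb{F}_q\}\cup\{(\infty)\}$, $a\in\mathbb{F}_q$; $l_{a,b}=\{(x,y):y=x\star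 a+b\}\cup\{(a)\}$. A hyperoval is a set of $q+2$ points no three collinear; a line hyperoval is a set of $q+2$ lines no three concurrent. *)

theory Defs
  imports "HOL-Computational_Algebra.Polynomial" "HOL-Library.Cardinality"
begin

text \<open>
  The field with \<open>q = 2^n\<close> elements is a type \<open>'a\<close> of class \<open>{finite, field}\<close> with
  \<open>CARD('a) = 2 ^ n\<close>; this hypothesis is made in the theorem, not in the definitions.
\<close>

text \<open>The absolute trace; its codomain, the prime field, is viewed as the subfield \<open>{0, 1}\<close> of \<open>'a\<close>.\<close>

definition Tr :: "nat \<Rightarrow> 'a::field \<Rightarrow> 'a" where
  "Tr n x = (\<Sum>i<n. x ^ (2 ^ i))"

definition knuth_mult :: "nat \<Rightarrow> 'a::field \<Rightarrow> 'a \<Rightarrow> 'a" where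
  "knuth_mult n x y = x * y + (y * Tr n x + x * Tr n y)\<^sup>2"

definition knuth_td_mult :: "nat \<Rightarrow> 'a::field \<Rightarrow> 'a \<Rightarrow> 'a" where
  "knuth_td_mult n x y = x * y + Tr n x * y ^ (2 ^ (n - 1)) + Tr n (x\<^sup>2 * y)"

text \<open>
  \<open>Affine a b\<close> is the point \<open>(a, b)\<close>; \<open>Ideal a\<close> and \<open>Ideal_Inf\<close> are the points at
  infinity \<open>(a)\<close> and \<open>(\<infinity>)\<close>. Lines are sets of points.
\<close>

datatype 'a point = Affine 'a 'a | Ideal 'a | Ideal_Inf

definition line_inf :: "'a point set" where
  "line_inf = insert Ideal_Inf (range Ideal)"

definition vert_line :: "'a \<Rightarrow> 'a point set" where
  "vert_line a = insert Ideal_Inf {Affine a y |y. True}"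

definition slope_line :: "('a::ab_group_add \<Rightarrow> 'a \<Rightarrow> 'a) \<Rightarrow> 'a \<Rightarrow> 'a \<Rightarrow> 'a point set" where
  "slope_line star a b = insert (Ideal a) {Affine x y |x y. y = star x a + b}"

text \<open>The plane of the presemifield with multiplication \<open>star\<close>, given by its set of lines.\<close>

definition plane :: "('a::ab_group_add \<Rightarrow> 'a \<Rightarrow> 'a) \<Rightarrow> 'a point set set" where
  "plane star = {line_inf} \<union> range vert_line \<union> {slope_line star a b |a b. True}"

definition hyperoval :: "'a::finite point set set \<Rightarrow> 'a point set \<Rightarrow> bool" where
  "hyperoval \<Pi> H \<longleftrightarrow> card H = CARD('a) + 2 \<and>
     \<not> (\<exists>P\<in>H. \<exists>Q\<in>H. \<exists>R\<in>H. P \<noteq> Q \<and> Q \<noteq> R \<and> P \<noteq> R \<and> (\<exists>l\<in>\<Pi>. {P, Q, R} \<subseteq> l))"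

definition line_hyperoval :: "'a::finite point set set \<Rightarrow> 'a point set set \<Rightarrow> bool" where
  "line_hyperoval \<Pi> D \<longleftrightarrow> D \<subseteq> \<Pi> \<and> card D = CARD('a) + 2 \<and>
     \<not> (\<exists>l\<in>D. \<exists>m\<in>D. \<exists>k\<in>D. l \<noteq> m \<and> m \<noteq> k \<and> l \<noteq> k \<and> (\<exists>P. P \<in> l \<and> P \<in> m \<and> P \<in> k))"

definition linearized :: "nat \<Rightarrow> (nat \<Rightarrow> 'a::field) \<Rightarrow> 'a poly" where
  "linearized n a = (\<Sum>i<n. monom (a i) (2 ^ i))"

text \<open>The adjoint of \<open>linearized n a\<close>, as an unreduced polynomial: the summand \<open>i = 0\<close> has degree \<open>2 ^ n\<close>.\<close>

definition adjoint :: "nat \<Rightarrow> (nat \<Rightarrow> 'a::field) \<Rightarrow> 'a poly" where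
  "adjoint n a = (\<Sum>i<n. monom (a i ^ (2 ^ (n - i))) (2 ^ (n - i)))"

end

theory Submission
  imports Defs "HOL-Computational_Algebra.Primes"
begin

text \<open>
  Either incidence condition says that a family of additive maps, parametrized by the field
  elements \<open>c\<close>, is injective for \<open>c = 0\<close> and at most two-to-one for every other \<open>c\<close>: the maps
  \<open>x \<mapsto> L(x) - x * c\<close> for the hyperoval, and \<open>m \<mapsto> L'(m) + c \<circ> m\<close> for the line hyperoval, where
  \<open>L'\<close> is the adjoint of \<open>L\<close>. For each \<open>c\<close> the two maps are adjoint with respect to the trace form
  \<open>Tr (x y)\<close>, because the characteristic is \<open>2\<close>, \<open>*\<close> is commutative and
  \<open>Tr (z (x * y)) = Tr (y (x \<circ> z))\<close>. Adjoint maps \<open>f\<close> and \<open>g\<close> have kernels of equal size: evaluate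
  \<open>\<Sum>\<^sub>x \<Sum>\<^sub>z (-1)\<^bsup>Tr (z f(x))\<^esup>\<close> by summing over \<open>z\<close> first, or over \<open>x\<close> first.
\<close>

section \<open>Fibres and kernels of additive maps\<close>

definition at_most_two_to_one :: "('a \<Rightarrow> 'b) \<Rightarrow> bool" where
  "at_most_two_to_one f \<longleftrightarrow>
     \<not> (\<exists>x y z. x \<noteq> y \<and> y \<noteq> z \<and> x \<noteq> z \<and> f x = f y \<and> f y = f z)"

text \<open>Nonempty fibres are cosets of the kernel: subtracting one element of a fibre moves the
  fibre into the kernel, and the kernel is itself the fibre over 0.\<close>

lemma at_most_two_to_one_iff_card_kernel:
  fixes f :: "'a::{finite, ab_group_add} \<Rightarrow> 'b::ab_group_add"
  assumes "additive f"
  shows "at_most_two_to_one f \<longleftrightarrow> card {x. f x = 0} \<le> 2"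
proof
  interpret additive f by fact
  assume *: "at_most_two_to_one f"
  show "card {x. f x = 0} \<le> 2"
  proof (rule ccontr)
    assume "\<not> card {x. f x = 0} \<le> 2"
    then have "3 \<le> card {x. f x = 0}" by simp
    then obtain T where "T \<subseteq> {x. f x = 0}" "card T = 3"
      by (meson obtain_subset_with_card_n)
    then obtain x y z where "x \<noteq> y" "y \<noteq> z" "x \<noteq> z" "f x = 0" "f y = 0" "f z = 0"
      by (auto simp: card_3_iff)
    then show False using * unfolding at_most_two_to_one_def by metis
  qed
next
  interpret additive f by fact
  assume le: "card {x. f x = 0} \<le> 2"
  show "at_most_two_to_one f"
    unfolding at_most_two_to_one_def
  proof (intro notI, elim exE conjE)
    fix x y z assume neq: "x \<noteq> y" "y \<noteq> z" "x \<noteq> z" and eq: "f x = f y" "f y = f z"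
    have "{0, y - x, z - x} \<subseteq> {x. f x = 0}" using eq by (simp add: zero diff)
    then have "card {0, y - x, z - x} \<le> card {x. f x = 0}" by (intro card_mono) auto
    moreover have "card {0, y - x, z - x} = 3" using neq by auto
    ultimately show False using le by simp
  qed
qed

lemma inj_iff_card_kernel:
  fixes f :: "'a::{finite, ab_group_add} \<Rightarrow> 'b::ab_group_add"
  assumes "additive f"
  shows "inj f \<longleftrightarrow> card {x. f x = 0} = 1"
proof -
  interpret additive f by fact
  have "inj f \<longleftrightarrow> (\<forall>x. f x = 0 \<longrightarrow> x = 0)"
  proof
    assume "inj f"
    then show "\<forall>x. f x = 0 \<longrightarrow> x = 0" using zero by (metis injD)
  next
    assume *: "\<forall>x. f x = 0 \<longrightarrow> x = 0"
    show "inj f"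
    proof (rule injI)
      fix x y assume "f x = f y"
      then have "f (x - y) = 0" by (simp add: diff)
      then have "x - y = 0" using * by blast
      then show "x = y" by simp
    qed
  qed
  also have "\<dots> \<longleftrightarrow> {x. f x = 0} = {0}"
    using zero by blast
  also have "\<dots> \<longleftrightarrow> card {x. f x = 0} = 1"
  proof
    assume "card {x. f x = 0} = 1"
    then obtain u where u: "{x. f x = 0} = {u}" by (rule card_1_singletonE)
    moreover from this zero have "0 \<in> {u}" by blast
    ultimately show "{x. f x = 0} = {0}" by simp
  qed simp
  finally show ?thesis .
qed

section \<open>Incidence conditions as conditions on fibres\<close>

lemma hyperoval_not_collinear:
  assumes "hyperoval \<Pi> H" "l \<in> \<Pi>" "P \<in> H" "Q \<in> H" "R \<in> H" "P \<noteq> Q" "Q \<noteq> R" "P \<noteq> R"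
  shows "\<not> {P, Q, R} \<subseteq> l"
  using assms unfolding hyperoval_def by blast

text \<open>Each vertical line and the line at infinity meet the set in exactly two points, so only
  lines of finite slope matter. A line of slope \<open>c\<close> and intercept \<open>b\<close>
  meets the graph where \<open>F x - star x c = b\<close>. Slope 0 is special: such a line also
  contains \<open>Ideal 0\<close>, which leaves room for only one point of the graph, whence
  injectivity of \<open>F\<close>.\<close>

lemma hyperoval_graph_iff:
  fixes star :: "'a::{finite, ab_group_add} \<Rightarrow> 'a \<Rightarrow> 'a"
  assumes star_0: "\<And>x. star x 0 = 0"
  shows "hyperoval (plane star) ({Affine x (F x) |x. True} \<union> {Ideal 0, Ideal_Inf}) \<longleftrightarrow>
           inj F \<and> (\<forall>c. c \<noteq> 0 \<longrightarrow> at_most_two_to_one (\<lambda>x. F x - star x c))"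
    (is "hyperoval _ ?H \<longleftrightarrow> ?R")
proof
  assume "hyperoval (plane star) ?H"
  moreover have "slope_line star c b \<in> plane star" for c b
    by (auto simp: plane_def)
  ultimately have no: "\<not> {P, Q, R} \<subseteq> slope_line star c b"
    if "P \<in> ?H" "Q \<in> ?H" "R \<in> ?H" "P \<noteq> Q" "Q \<noteq> R" "P \<noteq> R" for P Q R c b
    using that by (rule hyperoval_not_collinear)
  have graph_in: "Affine x (F x) \<in> ?H" and Ideal_in: "Ideal 0 \<in> ?H" for x by auto
  show ?R
  proof (intro conjI allI impI injI)
    fix x y assume "F x = F y"
    then show "x = y"
      using no[OF graph_in[of x] graph_in[of y] Ideal_in, of 0 "F x"]
      by (auto simp: slope_line_def star_0)
  next
    fix c :: 'a
    show "at_most_two_to_one (\<lambda>x. F x - star x c)"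
      unfolding at_most_two_to_one_def
    proof (intro notI, elim exE conjE)
      fix x y z assume neq: "x \<noteq> y" "y \<noteq> z" "x \<noteq> z"
        and eq: "F x - star x c = F y - star y c" "F y - star y c = F z - star z c"
      have "{Affine x (F x), Affine y (F y), Affine z (F z)} \<subseteq> slope_line star c (F z - star z c)"
        using eq by (auto simp: slope_line_def algebra_simps)
      then show False
        using neq
          no[OF graph_in[of x] graph_in[of y] graph_in[of z]] by auto
    qed
  qed
next
  assume R: ?R
  have "{Affine x (F x) |x. True} = range (\<lambda>x. Affine x (F x))" by auto
  moreover have "card (range (\<lambda>x. Affine x (F x))) = CARD('a)"
    by (rule card_image) (auto simp: inj_def)
  ultimately have card: "card ?H = CARD('a) + 2"
    by (subst card_Un_disjoint) auto
  have no: False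
    if PQR: "P \<in> ?H" "Q \<in> ?H" "R \<in> ?H" and neq: "P \<noteq> Q" "Q \<noteq> R" "P \<noteq> R"
      and l: "l \<in> plane star" "{P, Q, R} \<subseteq> l" for P Q R l
  proof -
    from l(1) consider "l = line_inf" | c where "l = vert_line c" | c b where "l = slope_line star c b"
      unfolding plane_def by blast
    then consider "l = line_inf" | c where "l = vert_line c"
      | b where "l = slope_line star 0 b" | c b where "c \<noteq> 0" "l = slope_line star c b"
      by metis
    then show False
    proof cases
      case 1
      then show False using PQR neq l by (auto simp: line_inf_def)
    next
      case 2
      then show False using PQR neq l by (auto simp: vert_line_def)
    next
      case 3
      \<comment> \<open>A line of slope 0 and intercept \<open>b\<close> can meet the set only in
        \<open>Ideal 0\<close> and the graph point over the unique preimage of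
        \<open>b\<close>.\<close>
      have "inv F (F x) = x" for x using R by simp
      then have T: "T = Ideal 0 \<or> T = Affine (inv F b) b" if "T \<in> ?H" "T \<in> l" for T
        using that 3 by (auto simp: slope_line_def star_0)
      show False
        using T[OF PQR(1)] T[OF PQR(2)] T[OF PQR(3)] l(2) neq by auto
    next
      case 4
      have T: "\<exists>x. T = Affine x (F x) \<and> F x - star x c = b" if "T \<in> ?H" "T \<in> l" for T
        using that 4 by (auto simp: slope_line_def diff_eq_eq add.commute)
      obtain x y z where "P = Affine x (F x)" "Q = Affine y (F y)" "R = Affine z (F z)"
        and "F x - star x c = b" "F y - star y c = b" "F z - star z c = b"
        using T[OF PQR(1)] T[OF PQR(2)] T[OF PQR(3)] l(2) by blast
      moreover from this neq have "x \<noteq> y" "y \<noteq> z" "x \<noteq> z" by auto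
      moreover have "at_most_two_to_one (\<lambda>x. F x - star x c)" using R 4 by blast
      ultimately show False unfolding at_most_two_to_one_def by metis
    qed
  qed
  show "hyperoval (plane star) ?H"
    unfolding hyperoval_def
    by (intro conjI notI card) (elim bexE conjE exE, rule no)
qed

text \<open>Dual to the count for points. Each point at infinity lies on exactly two of the lines:
  \<open>Ideal c\<close> on \<open>line_inf\<close> and the line of slope \<open>c\<close>,
  \<open>Ideal_Inf\<close> on \<open>line_inf\<close> and \<open>vert_line 0\<close>. The point
  \<open>Affine c y\<close> lies on the lines whose slope \<open>m\<close> satisfies
  \<open>G m + star c m = y\<close>, and for \<open>c = 0\<close> also on
  \<open>vert_line 0\<close>, so that at most one such \<open>m\<close> is allowed.\<close>

lemma line_hyperoval_graph_iff:
  fixes star :: "'a::{finite, ab_group_add} \<Rightarrow> 'a \<Rightarrow> 'a"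
  assumes star_0: "\<And>m. star 0 m = 0"
  shows "line_hyperoval (plane star)
             ({slope_line star m (G m) |m. True} \<union> {vert_line 0, line_inf}) \<longleftrightarrow>
           inj G \<and> (\<forall>c. c \<noteq> 0 \<longrightarrow> at_most_two_to_one (\<lambda>m. G m + star c m))"
    (is "line_hyperoval _ ?D \<longleftrightarrow> ?R")
proof -
  let ?s = "\<lambda>m. slope_line star m (G m)"
  have Affine_in_s [simp]: "Affine x y \<in> slope_line star m b \<longleftrightarrow> b + star x m = y" for x y m b
    by (auto simp: slope_line_def add.commute)
  have Ideal_in_s [simp]: "Ideal x \<in> slope_line star m b \<longleftrightarrow> m = x"
      "Ideal_Inf \<notin> slope_line star m b" for x m b
    by (auto simp: slope_line_def)
  \<comment> \<open>A line determines its slope by its ideal point and its intercept by its point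
    with abscissa 0, because \<open>star 0 m = 0\<close>. Hence distinct slopes give distinct lines
    in the count of \<open>?D\<close>.\<close>
  have s_eq [simp]: "slope_line star m b = slope_line star m' b' \<longleftrightarrow> m = m' \<and> b = b'" for m m' b b'
    using Affine_in_s[of 0 b] Ideal_in_s(1) by (metis add.right_neutral star_0)
  have in_vert [simp]: "Affine x y \<in> vert_line 0 \<longleftrightarrow> x = 0" "Ideal x \<notin> vert_line 0"
      "Ideal_Inf \<in> vert_line 0" for x y :: 'a
    by (auto simp: vert_line_def)
  have in_inf [simp]: "Affine x y \<notin> line_inf" "Ideal x \<in> line_inf" "Ideal_Inf \<in> line_inf"
    for x y :: 'a
    by (auto simp: line_inf_def)
  have s_neq [simp]: "slope_line star m b \<noteq> vert_line 0" "slope_line star m b \<noteq> line_inf" for m b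
    using Ideal_in_s(2) in_vert(3) in_inf(3) by metis+
  have vert_neq [simp]: "vert_line (0::'a) \<noteq> line_inf"
    using in_vert(2) in_inf(2) by metis
  show ?thesis
  proof
    assume "line_hyperoval (plane star) ?D"
    then have no: False
      if "k \<in> ?D" "l \<in> ?D" "m \<in> ?D" "k \<noteq> l" "l \<noteq> m" "k \<noteq> m" "P \<in> k" "P \<in> l" "P \<in> m"
      for k l m P
      using that unfolding line_hyperoval_def by blast
    have s_in: "?s m \<in> ?D" and vert_in: "vert_line 0 \<in> ?D" for m by auto
    show ?R
    proof (intro conjI allI impI injI)
      fix x y assume "G x = G y"
      then show "x = y"
        using no[of "?s x" "?s y" "vert_line 0" "Affine 0 (G x)", OF s_in s_in vert_in _ s_neq(1)]
        by (auto simp: star_0)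
    next
      fix c :: 'a
      show "at_most_two_to_one (\<lambda>m. G m + star c m)"
        unfolding at_most_two_to_one_def
      proof (intro notI, elim exE conjE)
        fix x y z assume "x \<noteq> y" "y \<noteq> z" "x \<noteq> z"
          and "G x + star c x = G y + star c y" "G y + star c y = G z + star c z"
        then show False
          using no[of "?s x" "?s y" "?s z" "Affine c (G x + star c x)", OF s_in s_in s_in] by auto
      qed
    qed
  next
    assume R: ?R
    have "{?s m |m. True} = range ?s" by auto
    moreover have "card (range ?s) = CARD('a)"
      by (rule card_image) (auto simp: inj_def)
    ultimately have card: "card ?D = CARD('a) + 2"
      by (subst card_Un_disjoint) (auto simp: s_neq[symmetric])
    have sub: "?D \<subseteq> plane star" by (auto simp: plane_def)
    have no: False
      if klm: "k \<in> ?D" "l \<in> ?D" "m \<in> ?D" and neq: "k \<noteq> l" "l \<noteq> m" "k \<noteq> m"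
        and P: "P \<in> k" "P \<in> l" "P \<in> m" for k l m P
    proof -
      consider "P = Ideal_Inf" | c where "P = Ideal c" | y where "P = Affine 0 y"
        | c y where "c \<noteq> 0" "P = Affine c y"
        by (metis point.exhaust)
      then show False
      proof cases
        case 1
        then show False using klm neq P by auto
      next
        case 2
        then show False using klm neq P by auto
      next
        case 3
        have "inv G (G m) = m" for m using R by simp
        then have t: "t = vert_line 0 \<or> t = slope_line star (inv G y) y"
          if "t \<in> ?D" "P \<in> t" for t
          using that 3 by (auto simp: star_0)
        show False
          using t[OF klm(1) P(1)] t[OF klm(2) P(2)] t[OF klm(3) P(3)] neq by blast
      next
        case 4
        have t: "\<exists>m. t = ?s m \<and> G m + star c m = y" if "t \<in> ?D" "P \<in> t" for t
          using that 4 by auto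
        obtain m1 m2 m3 where "k = ?s m1" "l = ?s m2" "m = ?s m3"
          and "G m1 + star c m1 = y" "G m2 + star c m2 = y" "G m3 + star c m3 = y"
          using t[OF klm(1) P(1)] t[OF klm(2) P(2)] t[OF klm(3) P(3)] by blast
        moreover from this neq have "m1 \<noteq> m2" "m2 \<noteq> m3" "m1 \<noteq> m3" by auto
        moreover have "at_most_two_to_one (\<lambda>m. G m + star c m)" using R 4 by blast
        ultimately show False unfolding at_most_two_to_one_def by metis
      qed
    qed
    show "line_hyperoval (plane star) ?D"
      unfolding line_hyperoval_def
      by (intro conjI notI sub card) (elim bexE conjE exE, rule no)
  qed
qed

section \<open>Fields with \<open>2 ^ n\<close> elements\<close>

context
  fixes n :: nat
  assumes card: "CARD('a::{finite, field}) = 2 ^ n"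
begin

text \<open>The sum of all field elements is unchanged by the shift \<open>x + 1\<close>, so the
  field size vanishes in the field and the prime characteristic divides
  \<open>2 ^ n\<close>.\<close>

lemma CHAR_eq_2: "CHAR('a) = 2"
proof -
  have "prime CHAR('a)"
    by (rule prime_CHAR_semidom) (rule finite_imp_CHAR_pos, simp)
  moreover have "(\<Sum>x\<in>UNIV. x + 1) = (\<Sum>x\<in>UNIV. x::'a)"
    by (rule sum.reindex_bij_witness[of _ "\<lambda>x. x - 1" "\<lambda>x. x + 1"]) auto
  then have "of_nat CARD('a) = (0::'a)" by (simp add: sum.distrib)
  then have "CHAR('a) dvd 2 ^ n"
    unfolding card by (simp only: of_nat_eq_0_iff_char_dvd)
  ultimately show ?thesis
    by (metis prime_dvd_power primes_dvd_imp_eq two_is_prime_nat)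
qed

lemma two_eq_zero: "(2::'a) = 0"
  using of_nat_CHAR[where ?'a = 'a] by (simp add: CHAR_eq_2)

lemma power_2_power_add: "(x + y) ^ 2 ^ k = x ^ 2 ^ k + (y::'a) ^ 2 ^ k"
  by (rule freshmans_dream') (simp_all add: CHAR_eq_2)

lemma power2_add: "(x + y)\<^sup>2 = x\<^sup>2 + (y::'a)\<^sup>2"
  by (rule freshmans_dream) (simp_all add: CHAR_eq_2)

lemma power2_sum_distrib: "(\<Sum>i\<in>I. f i :: 'a)\<^sup>2 = (\<Sum>i\<in>I. (f i)\<^sup>2)"
  by (rule freshmans_dream_sum) (simp_all add: CHAR_eq_2)

lemma exponent_pos: "n > 0"
proof (rule ccontr)
  assume "\<not> n > 0"
  then have "CARD('a) = 1" by (simp add: card)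
  then have "(0::'a) = 1" by (metis UNIV_I card_1_singletonE singletonD)
  then show False by simp
qed

text \<open>The library lemma \<open>finite_field_power_card_eq_same\<close> requires the class \<open>finite_field\<close>, which
  the sort \<open>{finite, field}\<close> does not entail.\<close>

lemma power_card: "(x::'a) ^ 2 ^ n = x"
proof (cases "x = 0")
  case True
  then show ?thesis by simp
next
  case False
  let ?U = "UNIV - {0::'a}"
  have "(\<Prod>y\<in>?U. x * y) = \<Prod>?U"
    by (rule prod.reindex_bij_witness[of _ "\<lambda>y. y / x" "\<lambda>y. x * y"]) (use False in auto)
  then have "x ^ card ?U * \<Prod>?U = \<Prod>?U" by (simp add: prod.distrib)
  moreover have "\<Prod>?U \<noteq> 0" by simp
  ultimately have "x ^ card ?U = 1" by simp
  then have "x ^ Suc (card ?U) = x" by (simp only: power_Suc mult_1_right)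
  moreover have "Suc (card ?U) = 2 ^ n"
    unfolding card[symmetric] by (rule card_Suc_Diff1) auto
  ultimately show ?thesis by simp
qed

section \<open>The absolute trace\<close>

lemma Tr_add: "Tr n (x + y) = Tr n x + Tr n (y::'a)"
  by (simp add: Tr_def power_2_power_add sum.distrib)

lemma Tr_0: "Tr n (0::'a) = 0"
  by (simp add: Tr_def power_0_left)

lemma Tr_sum: "Tr n (\<Sum>i\<in>I. f i :: 'a) = (\<Sum>i\<in>I. Tr n (f i))"
  by (induction I rule: infinite_finite_induct) (simp_all add: Tr_0 Tr_add)

text \<open>Squaring moves each summand of the trace to the next one; the last becomes
  \<open>x ^ 2 ^ n = x\<close>, which replaces the first.\<close>

lemma Tr_power2: "Tr n (x\<^sup>2) = Tr n (x::'a)"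
proof -
  have "Tr n (x\<^sup>2) = (\<Sum>i<n. x ^ 2 ^ Suc i)"
    by (simp add: Tr_def flip: power_mult)
  also have "\<dots> = (\<Sum>i<Suc n. x ^ 2 ^ i) - x"
    by (subst sum.lessThan_Suc_shift) simp
  also have "\<dots> = Tr n x"
    by (simp add: Tr_def power_card)
  finally show ?thesis .
qed

lemma Tr_power_2_power: "Tr n (x ^ 2 ^ k) = Tr n (x::'a)"
  by (induction k) (simp_all add: Tr_power2 power_mult mult.commute[of 2])

text \<open>The trace equals its own square, and in a field only 0 and 1 do.\<close>

lemma Tr_cases: "Tr n (x::'a) = 0 \<or> Tr n x = 1"
proof -
  have "(Tr n x)\<^sup>2 = Tr n (x\<^sup>2)"
    unfolding Tr_def power2_sum_distrib by (simp flip: power_mult add: mult.commute)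
  then have "(Tr n x)\<^sup>2 = Tr n x"
    by (simp only: Tr_power2)
  then show ?thesis
    by (simp add: power2_eq_square)
qed

lemma Tr_mult_Tr: "Tr n (x * Tr n y) = Tr n x * Tr n (y::'a)"
  using Tr_cases[of y] by (auto simp: Tr_0)

text \<open>As a polynomial the trace is nonzero of degree at most \<open>2 ^ (n - 1)\<close>, too
  small to have all \<open>2 ^ n\<close> field elements as roots.\<close>

lemma ex_Tr_neq_0: "\<exists>x::'a. Tr n x \<noteq> 0"
proof (rule ccontr)
  assume "\<not> ?thesis"
  then have zero: "Tr n x = 0" for x :: 'a by blast
  define p :: "'a poly" where "p = (\<Sum>i<n. monom 1 (2 ^ i))"
  have "poly p x = 0" for x
    using zero[of x] by (simp add: p_def Tr_def poly_sum poly_monom)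
  then have roots: "{x. poly p x = 0} = UNIV" by simp
  \<comment> \<open>Only the summand \<open>i = 0\<close> has degree 1, so this coefficient
    witnesses that \<open>p\<close> is nonzero.\<close>
  have "coeff p 1 = (\<Sum>i<n. if i = 0 then 1 else 0)"
    unfolding p_def coeff_sum by (intro sum.cong) (auto simp: coeff_monom)
  also have "\<dots> = 1" using exponent_pos by simp
  finally have "p \<noteq> 0" by auto
  have "degree p \<le> 2 ^ (n - 1)"
    unfolding p_def by (intro degree_sum_le) (auto intro!: order.trans[OF degree_monom_le])
  moreover have "(2::nat) ^ (n - 1) < 2 ^ n"
    using exponent_pos by (intro power_strict_increasing) auto
  moreover have "CARD('a) \<le> degree p"
    using card_poly_roots_bound[OF \<open>p \<noteq> 0\<close>] by (simp add: roots)
  ultimately show False unfolding card by linarith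
qed

section \<open>The canonical additive character and kernels of adjoint maps\<close>

definition tr_char :: "'a \<Rightarrow> int" where
  "tr_char x = (if Tr n x = 0 then 1 else - 1)"

lemma tr_char_add: "tr_char (x + y) = tr_char x * tr_char y"
  using Tr_cases[of x] Tr_cases[of y] by (auto simp: tr_char_def Tr_add two_eq_zero)

lemma sum_tr_char_mult: "(\<Sum>z\<in>UNIV. tr_char (z * c)) = (if c = 0 then CARD('a) else 0)"
proof (cases "c = 0")
  case True
  then show ?thesis by (simp add: tr_char_def Tr_0)
next
  case False
  obtain u where "Tr n (u::'a) \<noteq> 0" using ex_Tr_neq_0 by blast
  then have u: "tr_char u = - 1" by (simp add: tr_char_def)
  \<comment> \<open>Shifting \<open>z\<close> by \<open>u / c\<close> adds \<open>u\<close> to the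
    argument and so multiplies every term by \<open>tr_char u = - 1\<close>; an integer sum equal to
    its own negative is 0.\<close>
  have "(\<Sum>z\<in>UNIV. tr_char (z * c)) = (\<Sum>z\<in>UNIV. tr_char ((z + u / c) * c))"
    by (rule sum.reindex_bij_witness[of _ "\<lambda>z. z + u / c" "\<lambda>z. z - u / c"]) auto
  also have "\<dots> = - (\<Sum>z\<in>UNIV. tr_char (z * c))"
    using False by (simp add: distrib_right tr_char_add u sum_negf)
  finally show ?thesis using False by simp
qed

lemma card_kernel_adjoint:
  fixes f g :: "'a \<Rightarrow> 'a"
  assumes adj: "\<And>x z. Tr n (z * f x) = Tr n (x * g z)"
  shows "card {x. f x = 0} = card {z. g z = 0}"
proof -
  have double: "(\<Sum>x\<in>UNIV. \<Sum>z\<in>UNIV. tr_char (z * h x)) = CARD('a) * card {x. h x = 0}"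
    for h :: "'a \<Rightarrow> 'a"
    by (simp add: sum_tr_char_mult if_distrib sum.If_cases cong: if_cong)
  have "int (CARD('a) * card {x. f x = 0}) = (\<Sum>x\<in>UNIV. \<Sum>z\<in>UNIV. tr_char (z * f x))"
    by (simp only: double)
  also have "\<dots> = (\<Sum>z\<in>UNIV. \<Sum>x\<in>UNIV. tr_char (x * g z))"
    \<comment> \<open>The character depends only on the trace of its argument, so \<open>adj\<close>
      applies termwise.\<close>
    by (subst sum.swap) (simp add: tr_char_def adj)
  also have "\<dots> = int (CARD('a) * card {z. g z = 0})"
    by (simp only: double)
  finally show ?thesis by simp
qed

section \<open>Adjointness of the two multiplications\<close>

lemma knuth_mult_commute: "knuth_mult n x y = knuth_mult n y (x::'a)"
  by (simp add: knuth_mult_def add.commute mult.commute)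

lemma additive_knuth_mult: "additive (\<lambda>x. knuth_mult n x (c::'a))"
  by standard (simp add: knuth_mult_def Tr_add algebra_simps power2_add flip: power2_sum)

lemma additive_knuth_td_mult: "additive (knuth_td_mult n (c::'a))"
  by standard (simp add: knuth_td_mult_def Tr_add power_2_power_add algebra_simps)

text \<open>Traces are 0 or 1, so they equal their squares and can be pulled out of a trace. The
  term with \<open>y\<^sup>2\<close> is made linear in \<open>y\<close> by a square root:
  \<open>y * z ^ 2 ^ (n - 1)\<close> squares to \<open>z * y\<^sup>2\<close> and has the same trace.
  This explains the exponent in \<open>knuth_td_mult\<close>.\<close>

lemma Tr_mult_knuth_mult:
  "Tr n (z * knuth_mult n x y) = Tr n (y * knuth_td_mult n x (z::'a))"
proof -
  have "Tr n (y * z ^ 2 ^ (n - 1)) = Tr n ((y * z ^ 2 ^ (n - 1))\<^sup>2)"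
    by (simp add: Tr_power2)
  also have "(y * z ^ 2 ^ (n - 1))\<^sup>2 = z * y\<^sup>2"
    using exponent_pos power_card[of z] power_minus_mult[of n "2::nat"]
    by (simp add: power_mult_distrib mult.commute flip: power_mult)
  finally have root: "Tr n (y * z ^ 2 ^ (n - 1)) = Tr n (z * y\<^sup>2)" .
  have Tr2: "(Tr n w)\<^sup>2 = Tr n w" for w :: 'a
    using Tr_cases[of w] by auto
  have "Tr n (z * knuth_mult n x y)
      = Tr n (z * x * y) + Tr n (z * y\<^sup>2) * Tr n x + Tr n (z * x\<^sup>2) * Tr n y"
    by (simp add: knuth_mult_def power2_add power_mult_distrib Tr2 distrib_left Tr_add
        Tr_mult_Tr add.assoc flip: mult.assoc)
  also have "\<dots> = Tr n (y * x * z) + Tr n (y * z ^ 2 ^ (n - 1) * Tr n x) + Tr n (y * Tr n (x\<^sup>2 * z))"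
    unfolding Tr_mult_Tr root by (simp add: Tr_mult_Tr Tr_power2 mult_ac)
  also have "\<dots> = Tr n (y * knuth_td_mult n x z)"
    by (simp add: knuth_td_mult_def distrib_left Tr_add mult_ac)
  finally show ?thesis .
qed

section \<open>Linearized polynomials and their adjoints\<close>

lemma poly_linearized: "poly (linearized n a) (x::'a) = (\<Sum>i<n. a i * x ^ 2 ^ i)"
  by (simp add: linearized_def poly_sum poly_monom)

lemma poly_adjoint:
  "poly (adjoint n a) (x::'a) = (\<Sum>i<n. a i ^ 2 ^ (n - i) * x ^ 2 ^ (n - i))"
  by (simp add: adjoint_def poly_sum poly_monom)

lemma additive_linearized: "additive (poly (linearized n a :: 'a poly))"
  by standard (simp add: poly_linearized power_2_power_add distrib_left sum.distrib)

lemma additive_adjoint: "additive (poly (adjoint n a :: 'a poly))"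
  by standard (simp add: poly_adjoint power_2_power_add distrib_left sum.distrib)

text \<open>Raising the \<open>i\<close>-th summand to the power \<open>2 ^ (n - i)\<close>
  preserves its trace and completes \<open>x ^ 2 ^ i\<close> to \<open>x ^ 2 ^ n = x\<close>,
  leaving the \<open>i\<close>-th summand of the adjoint at \<open>z\<close>.\<close>

lemma Tr_mult_linearized:
  "Tr n (z * poly (linearized n a) x) = Tr n (x * poly (adjoint n a) (z::'a))"
proof -
  have "Tr n (z * (a i * x ^ 2 ^ i)) = Tr n (x * (a i ^ 2 ^ (n - i) * z ^ 2 ^ (n - i)))"
    if "i < n" for i
  proof -
    have "Tr n (z * (a i * x ^ 2 ^ i)) = Tr n ((z * (a i * x ^ 2 ^ i)) ^ 2 ^ (n - i))"
      by (simp only: Tr_power_2_power)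
    also have "(x ^ 2 ^ i) ^ 2 ^ (n - i) = x"
      using that power_card[of x] by (simp flip: power_mult power_add)
    then have "(z * (a i * x ^ 2 ^ i)) ^ 2 ^ (n - i)
        = x * (a i ^ 2 ^ (n - i) * z ^ 2 ^ (n - i))"
      by (simp add: power_mult_distrib mult_ac)
    finally show ?thesis .
  qed
  then show ?thesis
    by (simp add: poly_linearized poly_adjoint sum_distrib_left Tr_sum)
qed

end

theorem theorem3p1:
  fixes n :: nat and a :: "nat \<Rightarrow> 'a::{finite, field}"
  assumes "odd n" and "CARD('a) = 2 ^ n"
  shows "hyperoval (plane (knuth_mult n :: 'a \<Rightarrow> 'a \<Rightarrow> 'a))
           ({Affine x (poly (linearized n a) x) |x. True} \<union> {Ideal 0, Ideal_Inf})
     \<longleftrightarrow> line_hyperoval (plane (knuth_td_mult n :: 'a \<Rightarrow> 'a \<Rightarrow> 'a))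
           ({slope_line (knuth_td_mult n) m (poly (adjoint n a) m) |m. True}
              \<union> {vert_line 0, line_inf})"
proof -
  note q = assms(2)
  let ?L = "poly (linearized n a)" and ?L' = "poly (adjoint n a)"
  let ?f = "\<lambda>c x. ?L x - knuth_mult n x c" and ?g = "\<lambda>c m. ?L' m + knuth_td_mult n c m"
  interpret L: additive ?L by (rule additive_linearized[OF q])
  interpret L': additive ?L' by (rule additive_adjoint[OF q])
  have f: "additive (?f c)" for c
  proof -
    interpret additive "\<lambda>x. knuth_mult n x c" by (rule additive_knuth_mult[OF q])
    show ?thesis by standard (simp add: add L.add)
  qed
  have g: "additive (?g c)" for c
  proof -
    interpret additive "knuth_td_mult n c" by (rule additive_knuth_td_mult[OF q])
    show ?thesis by standard (simp add: add L'.add)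
  qed
  \<comment> \<open>In characteristic 2 the difference is a sum, and commutativity makes
    \<open>c\<close> the left factor, the one that \<open>Tr_mult_knuth_mult\<close> keeps
    fixed.\<close>
  have "?f c x = ?L x + knuth_mult n c x" for c x
    using minus_CHAR_2[OF CHAR_eq_2[OF q]] knuth_mult_commute[OF q] by simp
  then have "Tr n (z * ?f c x) = Tr n (x * ?g c z)" for c x z
    by (simp only: distrib_left Tr_add[OF q] Tr_mult_linearized[OF q] Tr_mult_knuth_mult[OF q])
  then have "card {x. ?f c x = 0} = card {m. ?g c m = 0}" for c
    by (rule card_kernel_adjoint[OF q])
  then have "at_most_two_to_one (?f c) \<longleftrightarrow> at_most_two_to_one (?g c)" for c
    by (simp only: at_most_two_to_one_iff_card_kernel[OF f] at_most_two_to_one_iff_card_kernel[OF g])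
  moreover have "inj ?L \<longleftrightarrow> inj ?L'"
    using card_kernel_adjoint[OF q Tr_mult_linearized[OF q]]
    by (simp only: inj_iff_card_kernel[OF L.additive_axioms] inj_iff_card_kernel[OF L'.additive_axioms])
  moreover have "knuth_mult n x 0 = 0" "knuth_td_mult n 0 x = 0" for x :: 'a
    using Tr_0[OF q] by (simp_all add: knuth_mult_def knuth_td_mult_def)
  ultimately show ?thesis
    by (subst hyperoval_graph_iff line_hyperoval_graph_iff, simp)+ simp
qed

end
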